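(* Let $U,V$ be Hilbert spaces, $B\colon U\to V'$ a bounded linear operator with associated bilinear form $b(w,v)=(Bw)(v)$, let $V_h\subseteq V$ be a finite-dimensional subspace equipped with a norm $\|\cdot\|_{V_h}$ induced by an inner product and satisfying $$C_{\mathrm{equiv}}^{-1}\|v\|_V\le \|v\|_{V_h}\le C_{\mathrm{equiv}}\|v\|_V\qquad\forall v\in V_h$$ for a constant $C_{\mathrm{equiv}}>0$, and let $\Pi_h\colon V\to V_h$ be a bounded linear operator. Let $u\in U$ be given, and let $\eta$, $\mu$ and $U_0(\Pi_h)$ be as defined in the context. Then, for all $w\in U$, $$C_{\mathrm{equiv}}^{-1}\,\eta(w)\le \|B(u-w)\|_{V'}\le C_{\mathrm{equiv}}\,\|\Pi_h\|\,\eta(w)+\mu(w)$$ and $$\mu(w)\le \|1-\Pi_h\|\inf_{w_0\in U_0(\Pi_h)}\|B(u-w-w_0)\|_{V'}\le \|1-\Pi_h\|\,\|B(u-w)\|_{V'}.$$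
   Context: $V'$ is the dual of $V$ with the dual norm $\|\cdot\|_{V'}$. The norms $\|\Pi_h\|$ and $\|1-\Pi_h\|$ are operator norms on $(V,\|\cdot\|_V)$ (with $V_h\subseteq V$ carrying $\|\cdot\|_V$). For the given $u\in U$ and any $w\in U$ define $$\eta(w)=\sup_{0\ne v\in V_h}\frac{b(u-w,v)}{\|v\|_{V_h}}=\|B(u-w)\|_{V_h'},\qquad \mu(w)=\sup_{0\ne v\in V}\frac{b(w-u,v-\Pi_hv)}{\|v\|_V},$$ where $V_h'$ carries the dual norm with respect to $\|\cdot\|_{V_h}$, and define the kernel space $$U_0(\Pi_h)=\{w\in U: b(w,v-\Pi_hv)=0\ \ \forall v\in V\}.$$ *)

theory Defs
  imports "HOL-Analysis.Analysis"
begin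

definition inner_product_on :: "'a::real_vector set \<Rightarrow> ('a \<Rightarrow> 'a \<Rightarrow> real) \<Rightarrow> bool" where
  "inner_product_on S ip \<longleftrightarrow>
     (\<forall>x\<in>S. \<forall>y\<in>S. ip x y = ip y x) \<and>
     (\<forall>x\<in>S. \<forall>y\<in>S. \<forall>z\<in>S. ip (x + y) z = ip x z + ip y z) \<and>
     (\<forall>c. \<forall>x\<in>S. \<forall>y\<in>S. ip (c *\<^sub>R x) y = c * ip x y) \<and>
     (\<forall>x\<in>S. x \<noteq> 0 \<longrightarrow> ip x x > 0)"

text \<open>Suprema over nonzero vectors of a subspace range over the empty set when the subspace
  is trivial. The intended value is then 0 (the norm of the only functional on the zero space),
  whereas the library's real-valued supremum of the empty set is unspecified.\<close>

definition sup0 :: "real set \<Rightarrow> real" where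
  "sup0 A = (if A = {} then 0 else Sup A)"

definition bform ::
  "('u::real_normed_vector \<Rightarrow>\<^sub>L ('v::real_normed_vector \<Rightarrow>\<^sub>L real)) \<Rightarrow> 'u \<Rightarrow> 'v \<Rightarrow> real" where
  "bform B w v = blinfun_apply (blinfun_apply B w) v"

definition eta ::
  "('u::real_normed_vector \<Rightarrow>\<^sub>L ('v::real_normed_vector \<Rightarrow>\<^sub>L real)) \<Rightarrow> 'v set \<Rightarrow> ('v \<Rightarrow> real)
    \<Rightarrow> 'u \<Rightarrow> 'u \<Rightarrow> real" where
  "eta B Vh nrm_h u w = sup0 ((\<lambda>v. bform B (u - w) v / nrm_h v) ` {v \<in> Vh. v \<noteq> 0})"

definition mu ::
  "('u::real_normed_vector \<Rightarrow>\<^sub>L ('v::real_normed_vector \<Rightarrow>\<^sub>L real)) \<Rightarrow> ('v \<Rightarrow>\<^sub>L 'v)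
    \<Rightarrow> 'u \<Rightarrow> 'u \<Rightarrow> real" where
  "mu B Ph u w = sup0 ((\<lambda>v. bform B (w - u) (v - blinfun_apply Ph v) / norm v) ` {v. v \<noteq> 0})"

definition kernel_space ::
  "('u::real_normed_vector \<Rightarrow>\<^sub>L ('v::real_normed_vector \<Rightarrow>\<^sub>L real)) \<Rightarrow> ('v \<Rightarrow>\<^sub>L 'v)
    \<Rightarrow> 'u set" where
  "kernel_space B Ph = {w. \<forall>v. bform B w (v - blinfun_apply Ph v) = 0}"

end

theory Submission imports Defs
begin

text \<open>For every \<open>v\<close>, split \<open>b(u - w, v) = b(u - w, \<Pi>v) + b(w - u, (-v) - \<Pi>(-v))\<close>; the first term
  is controlled by \<open>\<eta>(w)\<close> and norm equivalence, the second by \<open>\<mu>(w)\<close>. Elements of the kernel space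
  do not contribute to \<open>b(\<cdot>, v - \<Pi>v)\<close>, so they may be subtracted freely in the bound for \<open>\<mu>(w)\<close>.\<close>

text \<open>The condition \<open>0 \<le> K\<close> covers the empty set, where \<open>sup0\<close>
  takes the value 0.\<close>

lemma sup0_least:
  assumes "\<And>a. a \<in> A \<Longrightarrow> a \<le> K" and "0 \<le> K"
  shows "sup0 A \<le> K"
  using assms by (auto simp: sup0_def intro: cSup_least)

lemma sup0_upper:
  assumes "a \<in> A" and "\<And>a. a \<in> A \<Longrightarrow> a \<le> K"
  shows "a \<le> sup0 A"
  using assms by (auto simp: sup0_def intro!: cSup_upper bdd_aboveI)

text \<open>The supremum dominates some \<open>a\<close> together with \<open>- a\<close>. This
  replaces the absolute values that the quotients in \<open>eta\<close> and \<open>mu\<close> do not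
  carry.\<close>

lemma sup0_symmetric_nonneg:
  assumes bound: "\<And>a. a \<in> A \<Longrightarrow> a \<le> K" and sym: "\<And>a. a \<in> A \<Longrightarrow> - a \<in> A"
  shows "0 \<le> sup0 A"
proof (cases "A = {}")
  case False
  then obtain a where "a \<in> A" by blast
  then have "a \<le> sup0 A" "- a \<le> sup0 A"
    using sup0_upper[of _ A K] bound sym by blast+
  then show ?thesis by linarith
qed (simp add: sup0_def)

text \<open>Makes \<open>nrm_h\<close> an even function on \<open>Vh\<close>. Linearity is
  postulated in the first argument only, so the sign in the second one is pulled out by
  symmetry.\<close>

lemma inner_product_on_uminus:
  assumes "inner_product_on S ip" "subspace S" "x \<in> S"
  shows "ip (- x) (- x) = ip x x"
proof -
  have sym: "ip y z = ip z y" if "y \<in> S" "z \<in> S" for y z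
    using assms(1) that by (simp add: inner_product_on_def)
  have neg: "ip (- y) z = - ip y z" if "y \<in> S" "z \<in> S" for y z
  proof -
    have "ip ((- 1) *\<^sub>R y) z = (- 1) * ip y z"
      using assms(1) that unfolding inner_product_on_def by blast
    then show ?thesis by simp
  qed
  have "- x \<in> S" using assms(2,3) by (rule subspace_neg)
  then show ?thesis using assms(3) neg sym by (metis minus_minus)
qed

lemma bform_le: "bform B w v \<le> norm (blinfun_apply B w) * norm v"
  unfolding bform_def using norm_blinfun[of "blinfun_apply B w" v] by simp

lemma bform_uminus_right: "bform B w (- v) = - bform B w v"
  by (simp add: bform_def blinfun.minus_right)

lemma bform_residual_le:
  assumes "w0 \<in> kernel_space B Ph"
  shows "bform B (w - u) (v - blinfun_apply Ph v)
    \<le> norm (id_blinfun - Ph) * norm (blinfun_apply B (u - w - w0)) * norm v"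
proof -
  \<comment> \<open>The argument \<open>- v\<close> absorbs the change of sign from
    \<open>w - u\<close> to \<open>u - w - w0\<close>.\<close>
  let ?r = "blinfun_apply (id_blinfun - Ph) (- v)"
  have r: "?r = - (v - blinfun_apply Ph v)"
    by (simp add: blinfun.diff_left blinfun.minus_right)
  have "bform B w0 (v - blinfun_apply Ph v) = 0"
    using assms by (simp add: kernel_space_def)
  then have "bform B (w - u) (v - blinfun_apply Ph v) = bform B (u - w - w0) ?r"
    unfolding r by (simp add: bform_def blinfun.diff_right blinfun.diff_left blinfun.minus_right)
  also have "\<dots> \<le> norm (blinfun_apply B (u - w - w0)) * norm ?r" by (rule bform_le)
  also have "\<dots> \<le> norm (blinfun_apply B (u - w - w0)) * (norm (id_blinfun - Ph) * norm v)"
    using norm_blinfun[of "id_blinfun - Ph" "- v"] by (intro mult_left_mono) auto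
  finally show ?thesis by (simp add: mult_ac)
qed

lemma zero_in_kernel_space: "0 \<in> kernel_space B Ph"
  by (simp add: kernel_space_def bform_def)

lemma mu_le:
  assumes "w0 \<in> kernel_space B Ph"
  shows "mu B Ph u w \<le> norm (id_blinfun - Ph) * norm (blinfun_apply B (u - w - w0))"
  unfolding mu_def
proof (rule sup0_least)
  fix a assume "a \<in> (\<lambda>v. bform B (w - u) (v - blinfun_apply Ph v) / norm v) ` {v. v \<noteq> 0}"
  then show "a \<le> norm (id_blinfun - Ph) * norm (blinfun_apply B (u - w - w0))"
    using bform_residual_le[OF assms] by (auto simp: divide_le_eq)
qed simp

lemma
  fixes Ph :: "'v::real_normed_vector \<Rightarrow>\<^sub>L 'v"
  shows bform_le_mu: "bform B (w - u) (v - blinfun_apply Ph v) \<le> mu B Ph u w * norm v"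
    and mu_nonneg: "0 \<le> mu B Ph u w"
proof -
  let ?A = "(\<lambda>v. bform B (w - u) (v - blinfun_apply Ph v) / norm v) ` {v. v \<noteq> 0}"
  \<comment> \<open>The choice \<open>w0 = 0\<close> gives an upper bound of the quotients, so that
    their supremum is a genuine one.\<close>
  let ?K = "norm (id_blinfun - Ph) * norm (blinfun_apply B (u - w - 0))"
  have bound: "a \<le> ?K" if "a \<in> ?A" for a
    using that bform_residual_le[OF zero_in_kernel_space, of B w u _ Ph]
    by (auto simp: divide_le_eq)
  have sym: "- a \<in> ?A" if "a \<in> ?A" for a
  proof -
    obtain v where "v \<noteq> 0" and a: "a = bform B (w - u) (v - blinfun_apply Ph v) / norm v"
      using \<open>a \<in> ?A\<close> by auto
    have "- v - blinfun_apply Ph (- v) = - (v - blinfun_apply Ph v)"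
      by (simp add: blinfun.minus_right)
    then have "- a = bform B (w - u) (- v - blinfun_apply Ph (- v)) / norm (- v)"
      unfolding a by (metis bform_uminus_right minus_divide_left norm_minus_cancel)
    then show ?thesis using \<open>v \<noteq> 0\<close>
      by (intro image_eqI[of _ _ "- v"]) auto
  qed
  show "0 \<le> mu B Ph u w"
    unfolding mu_def using bound sym by (rule sup0_symmetric_nonneg)
  show "bform B (w - u) (v - blinfun_apply Ph v) \<le> mu B Ph u w * norm v"
  proof (cases "v = 0")
    case False
    then have "bform B (w - u) (v - blinfun_apply Ph v) / norm v \<le> mu B Ph u w"
      unfolding mu_def by (intro sup0_upper[where K = ?K] bound) auto
    then show ?thesis using False by (simp add: divide_le_eq)
  qed (simp add: bform_def)
qed

context
  fixes B :: "'u::real_normed_vector \<Rightarrow>\<^sub>L ('v::real_normed_vector \<Rightarrow>\<^sub>L real)"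
    and Vh :: "'v set" and nrm_h :: "'v \<Rightarrow> real" and C :: real
  assumes C_pos: "C > 0"
    and norm_le: "\<And>v. v \<in> Vh \<Longrightarrow> inverse C * norm v \<le> nrm_h v"
begin

lemma nrm_h_pos: "0 < nrm_h v" if "v \<in> Vh" "v \<noteq> 0"
proof -
  have "0 < inverse C * norm v" using C_pos that(2) by simp
  then show ?thesis using norm_le[OF that(1)] by linarith
qed

text \<open>Combines the dual norm estimate with \<open>norm v \<le> C * nrm_h v\<close>. It serves
  both to bound \<open>eta\<close> and to show that the quotients are bounded above.\<close>

lemma bform_quotient_le:
  assumes "v \<in> Vh" "v \<noteq> 0"
  shows "bform B w v / nrm_h v \<le> C * norm (blinfun_apply B w)"
proof -
  have "norm v \<le> C * nrm_h v"
    using norm_le[OF assms(1)] C_pos by (simp add: field_simps)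
  then have "norm (blinfun_apply B w) * norm v \<le> norm (blinfun_apply B w) * (C * nrm_h v)"
    by (intro mult_left_mono) auto
  then have "bform B w v \<le> C * norm (blinfun_apply B w) * nrm_h v"
    using bform_le[of B w v] by (simp add: mult_ac)
  then show ?thesis using nrm_h_pos[OF assms] by (simp add: divide_le_eq)
qed

lemma eta_le: "eta B Vh nrm_h u w \<le> C * norm (blinfun_apply B (u - w))"
  unfolding eta_def using C_pos by (intro sup0_least) (auto intro: bform_quotient_le)

lemma bform_le_eta:
  assumes "v \<in> Vh" "v \<noteq> 0"
  shows "bform B (u - w) v \<le> eta B Vh nrm_h u w * nrm_h v"
proof -
  have "bform B (u - w) v / nrm_h v \<le> eta B Vh nrm_h u w"
    unfolding eta_def using assms
    by (intro sup0_upper[where K = "C * norm (blinfun_apply B (u - w))"])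
      (auto intro: bform_quotient_le)
  then show ?thesis using nrm_h_pos[OF assms] by (simp add: divide_le_eq)
qed

text \<open>Evenness of \<open>nrm_h\<close> on \<open>Vh\<close> makes the set of quotients
  symmetric about 0.\<close>

lemma eta_nonneg:
  assumes "subspace Vh" and "\<And>v. v \<in> Vh \<Longrightarrow> nrm_h (- v) = nrm_h v"
  shows "0 \<le> eta B Vh nrm_h u w"
  unfolding eta_def
proof (rule sup0_symmetric_nonneg)
  let ?A = "(\<lambda>v. bform B (u - w) v / nrm_h v) ` {v \<in> Vh. v \<noteq> 0}"
  show "a \<le> C * norm (blinfun_apply B (u - w))" if "a \<in> ?A" for a
    using that by (auto intro: bform_quotient_le)
  show "- a \<in> ?A" if "a \<in> ?A" for a
  proof -
    obtain v where "v \<in> Vh" "v \<noteq> 0" "a = bform B (u - w) v / nrm_h v"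
      using \<open>a \<in> ?A\<close> by auto
    then show ?thesis using assms
      by (intro image_eqI[of _ _ "- v"]) (auto simp: bform_uminus_right subspace_neg)
  qed
qed

end

theorem theorem1:
  fixes B :: "'u::{real_inner,complete_space} \<Rightarrow>\<^sub>L ('v::{real_inner,complete_space} \<Rightarrow>\<^sub>L real)"
    and Vh :: "'v set"
    and ip_h :: "'v \<Rightarrow> 'v \<Rightarrow> real"
    and nrm_h :: "'v \<Rightarrow> real"
    and C :: real
    and Ph :: "'v \<Rightarrow>\<^sub>L 'v"
    and u :: 'u
  assumes "subspace Vh"
    and "\<exists>S. finite S \<and> Vh = span S"
    and "inner_product_on Vh ip_h"
    and "\<forall>v\<in>Vh. nrm_h v = sqrt (ip_h v v)"
    and "C > 0"
    and "\<forall>v\<in>Vh. inverse C * norm v \<le> nrm_h v \<and> nrm_h v \<le> C * norm v"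
    and "\<forall>v. blinfun_apply Ph v \<in> Vh"
  shows "\<forall>w.
     inverse C * eta B Vh nrm_h u w \<le> norm (blinfun_apply B (u - w)) \<and>
     norm (blinfun_apply B (u - w)) \<le> C * norm Ph * eta B Vh nrm_h u w + mu B Ph u w \<and>
     mu B Ph u w
       \<le> norm (id_blinfun - Ph) * (INF w0\<in>kernel_space B Ph. norm (blinfun_apply B (u - w - w0))) \<and>
     norm (id_blinfun - Ph) * (INF w0\<in>kernel_space B Ph. norm (blinfun_apply B (u - w - w0)))
       \<le> norm (id_blinfun - Ph) * norm (blinfun_apply B (u - w))"
proof (intro allI conjI)
  fix w
  let ?eta = "eta B Vh nrm_h u w" and ?mu = "mu B Ph u w"
  let ?N = "\<lambda>w0. norm (blinfun_apply B (u - w - w0))"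
  have lower: "\<And>v. v \<in> Vh \<Longrightarrow> inverse C * norm v \<le> nrm_h v"
    and upper: "\<And>v. v \<in> Vh \<Longrightarrow> nrm_h v \<le> C * norm v"
    using assms(6) by auto
  have "nrm_h (- v) = nrm_h v" if "v \<in> Vh" for v
    using inner_product_on_uminus[OF assms(3,1) that] assms(4) that subspace_neg[OF assms(1) that]
    by simp
  then have eta_nonneg: "0 \<le> ?eta"
    using eta_nonneg[of C Vh nrm_h B u w] assms(1,5) lower by blast
  show "inverse C * ?eta \<le> norm (blinfun_apply B (u - w))"
    using eta_le[of C Vh nrm_h B u w] assms(5) lower by (simp add: field_simps)
  have bform_Ph_le: "bform B (u - w) (blinfun_apply Ph v) \<le> C * norm Ph * ?eta * norm v" for v
  \<comment> \<open>The bound by \<open>eta\<close> concerns nonzero vectors of \<open>Vh\<close>.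
    If \<open>Ph\<close> maps \<open>v\<close> to 0, the left side vanishes and the right side is
    nonnegative.\<close>
  proof (cases "blinfun_apply Ph v = 0")
    case True
    then show ?thesis using eta_nonneg assms(5) by (simp add: bform_def)
  next
    case False
    have Vh: "blinfun_apply Ph v \<in> Vh" using assms(7) by blast
    have "bform B (u - w) (blinfun_apply Ph v) \<le> ?eta * nrm_h (blinfun_apply Ph v)"
      using bform_le_eta[OF assms(5) lower Vh False] .
    also have "\<dots> \<le> ?eta * (C * (norm Ph * norm v))"
    \<comment> \<open>Nonnegativity of \<open>eta\<close> is what allows \<open>nrm_h\<close> to be
      replaced by its upper bound inside the product.\<close>
    proof (rule mult_left_mono[OF _ eta_nonneg])
      have "C * norm (blinfun_apply Ph v) \<le> C * (norm Ph * norm v)"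
        using assms(5) norm_blinfun by (intro mult_left_mono) auto
      then show "nrm_h (blinfun_apply Ph v) \<le> C * (norm Ph * norm v)"
        using upper[OF Vh] by linarith
    qed
    finally show ?thesis by (simp add: mult_ac)
  qed
  have le: "blinfun_apply (blinfun_apply B (u - w)) v \<le> (C * norm Ph * ?eta + ?mu) * norm v" for v
  proof -
    have "blinfun_apply (blinfun_apply B (u - w)) v
        = bform B (u - w) (blinfun_apply Ph v) + bform B (w - u) (- v - blinfun_apply Ph (- v))"
      by (simp add: bform_def blinfun.diff_right blinfun.diff_left blinfun.minus_right)
    also have "\<dots> \<le> C * norm Ph * ?eta * norm v + ?mu * norm v"
      using bform_Ph_le[of v] bform_le_mu[of B w u "- v" Ph] by simp
    finally show ?thesis by (simp add: distrib_right)
  qed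
  show "norm (blinfun_apply B (u - w)) \<le> C * norm Ph * ?eta + ?mu"
  proof (rule norm_blinfun_bound)
    show "0 \<le> C * norm Ph * ?eta + ?mu"
      using eta_nonneg mu_nonneg[of B Ph u w] assms(5) by simp
    show "norm (blinfun_apply (blinfun_apply B (u - w)) v)
        \<le> (C * norm Ph * ?eta + ?mu) * norm v" for v
      \<comment> \<open>The one-sided estimates at \<open>v\<close> and \<open>- v\<close> together
        bound the absolute value.\<close>
      using le[of v] le[of "- v"] by (simp add: blinfun.minus_right abs_le_iff)
  qed
  show "?mu \<le> norm (id_blinfun - Ph) * (INF w0\<in>kernel_space B Ph. ?N w0)"
  \<comment> \<open>To pass from a bound for each \<open>w0\<close> to the infimum, the factor is
    divided out first. When it is zero, \<open>mu_le\<close> at \<open>w0 = 0\<close> already gives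
    \<open>?mu \<le> 0\<close>.\<close>
  proof (cases "norm (id_blinfun - Ph) = 0")
    case True
    then show ?thesis using mu_le[OF zero_in_kernel_space, of B Ph u w] by simp
  next
    case False
    then have pos: "0 < norm (id_blinfun - Ph)" by simp
    have "?mu / norm (id_blinfun - Ph) \<le> (INF w0\<in>kernel_space B Ph. ?N w0)"
    proof (rule cINF_greatest)
      show "?mu / norm (id_blinfun - Ph) \<le> ?N w0" if "w0 \<in> kernel_space B Ph" for w0
        using mu_le[OF that, of u w] pos by (simp add: divide_le_eq mult.commute)
    \<comment> \<open>The infimum must range over a nonempty set, and 0 is always a member.\<close>
    qed (use zero_in_kernel_space in blast)
    then show ?thesis using pos by (simp add: divide_le_eq mult.commute)
  qed
  \<comment> \<open>The infimum lies below the value at \<open>w0 = 0\<close>, since norms are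
    bounded below by 0.\<close>
  have "(INF w0\<in>kernel_space B Ph. ?N w0) \<le> ?N 0"
    by (intro cINF_lower bdd_belowI[of _ 0] zero_in_kernel_space) auto
  then show "norm (id_blinfun - Ph) * (INF w0\<in>kernel_space B Ph. ?N w0)
      \<le> norm (id_blinfun - Ph) * norm (blinfun_apply B (u - w))"
    by (intro mult_left_mono) auto
qed

end
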